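(* Let $r,d\ge1$ be integers, $N=r+d$, and let $H=\begin{bmatrix}A&B\\C&D\end{bmatrix}\in M_N(\pm1)$ be a Hadamard matrix with $A\in M_r(\pm1)$ and $D\in M_d(\pm1)$. (1) If $A$ is Hadamard, and $N>r(r-1)^2$, then $D$ is AHP. (2) If $A$ is invertible and $N>\frac{r^2}{4}\left(x+\sqrt{x^2+4}\right)^2$, where $x=r\left\|Pol(A)-\frac{A}{\sqrt N}\right\|_\infty$, then $D$ is AHP. (3) If $A$ is invertible and $N>\frac{r^2}{4}\left(r+\sqrt{r^2+8}\right)^2$, then $D$ is AHP.
   Context: $M_n(\pm1)$ denotes the set of $n\times n$ matrices with entries in $\{-1,1\}$; a Hadamard matrix is a matrix in $M_n(\pm1)$ whose rows are pairwise orthogonal. $\|M\|_\infty=\max_{i,j}|M_{ij}|$ and $\|M\|_1=\sum_{i,j}|M_{ij}|$. For an invertible real matrix $A$, $Pol(A)$ is the unique orthogonal matrix $V$ in the polar decomposition $A=V\sqrt{A^tA}$. A matrix $K\in M_n(\mathbb R)$ is called almost Hadamard (AHM) if $U=K/\sqrt n$ is orthogonal and is a local maximum of the $1$-norm on the orthogonal group $O(n)$. A matrix $S\in M_n(\pm1)$ is called an almost Hadamard sign pattern (AHP) if there exists an almost Hadamard matrix $K\in M_n(\mathbb R)$ such that $S_{ij}=\mathrm{sgn}(K_{ij})$ for all $i,j$. *)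

theory Defs
  imports "HOL-Analysis.Analysis"
begin

definition pm1_matrix :: "real^'n^'m \<Rightarrow> bool" where
  "pm1_matrix M \<longleftrightarrow> (\<forall>i j. M $ i $ j \<in> {-1, 1})"

definition hadamard_matrix :: "real^'n^'n \<Rightarrow> bool" where
  "hadamard_matrix H \<longleftrightarrow>
     pm1_matrix H \<and> (\<forall>i j. i \<noteq> j \<longrightarrow> orthogonal (row i H) (row j H))"

text \<open>The norms below are entrywise; they are not operator norms.\<close>

definition entry_max_norm :: "real^'n^'m \<Rightarrow> real" where
  "entry_max_norm M = Max {\<bar>M $ i $ j\<bar> | i j. True}"

definition entry_one_norm :: "real^'n^'m \<Rightarrow> real" where
  "entry_one_norm M = (\<Sum>i\<in>UNIV. \<Sum>j\<in>UNIV. \<bar>M $ i $ j\<bar>)"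

definition psd_matrix :: "real^'n^'n \<Rightarrow> bool" where
  "psd_matrix P \<longleftrightarrow> transpose P = P \<and> (\<forall>v. 0 \<le> v \<bullet> (P *v v))"

definition matrix_sqrt :: "real^'n^'n \<Rightarrow> real^'n^'n" where
  "matrix_sqrt M = (THE P. psd_matrix P \<and> P ** P = M)"

text \<open>Only meaningful for invertible \<open>A\<close>, where the orthogonal factor is unique.\<close>

definition Pol :: "real^'n^'n \<Rightarrow> real^'n^'n" where
  "Pol A = (THE V. orthogonal_matrix V \<and> A = V ** matrix_sqrt (transpose A ** A))"

definition local_max_on :: "('a::topological_space \<Rightarrow> real) \<Rightarrow> 'a set \<Rightarrow> 'a \<Rightarrow> bool" where
  "local_max_on f S x \<longleftrightarrow> x \<in> S \<and> (\<forall>\<^sub>F y in at x within S. f y \<le> f x)"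

definition almost_hadamard_matrix :: "real^'n^'n \<Rightarrow> bool" where
  "almost_hadamard_matrix K \<longleftrightarrow>
     local_max_on entry_one_norm {V. orthogonal_matrix V} ((1 / sqrt (real CARD('n))) *\<^sub>R K)"

definition almost_hadamard_pattern :: "real^'n^'n \<Rightarrow> bool" where
  "almost_hadamard_pattern S \<longleftrightarrow>
     pm1_matrix S \<and>
     (\<exists>K :: real^'n^'n. almost_hadamard_matrix K \<and> (\<forall>i j. S $ i $ j = sgn (K $ i $ j)))"

definition block_matrix ::
  "real^'r^'r \<Rightarrow> real^'d^'r \<Rightarrow> real^'r^'d \<Rightarrow> real^'d^'d \<Rightarrow> real^('r + 'd)^('r + 'd)" where
  "block_matrix A B C D = (\<chi> i j.
     case i of
       Inl k \<Rightarrow> (case j of Inl l \<Rightarrow> A $ k $ l | Inr l \<Rightarrow> B $ k $ l)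
     | Inr k \<Rightarrow> (case j of Inl l \<Rightarrow> C $ k $ l | Inr l \<Rightarrow> D $ k $ l))"

end

theory Submission
  imports Defs
begin

text \<open>
  Put \<open>s = \<surd>N\<close> and let \<open>A = V P\<close> be a polar decomposition, with \<open>V\<close> orthogonal and \<open>P\<close> positive
  semidefinite. The polar part of the complementary block is then known explicitly: the matrix
  \<open>W = (D - E) / s\<close> with \<open>E = C (s + P)\<^sup>-\<^sup>1 V\<^sup>t B\<close> is orthogonal, and \<open>W\<^sup>t D\<close> is positive semidefinite
  (\<open>complement_orthogonal_psd\<close>). Both follow from the orthogonality of the columns of the Hadamard
  matrix, read block by block.

  If all entries of \<open>E\<close> are smaller than one in absolute value, then \<open>W\<close> has the signs of \<open>D\<close> and
  no zero entry. Near \<open>W\<close> the 1-norm is therefore the linear functional \<open>V \<mapsto> D \<bullet> V\<close>. Because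
  \<open>W\<^sup>t D\<close> is semidefinite, \<open>W\<close> maximises this functional over the entire orthogonal group
  (\<open>inner_le_if_psd\<close>), so \<open>W\<close> is a local maximum of the 1-norm and \<open>D\<close> is its sign pattern.

  What remains is to bound \<open>E = C Z B\<close>, where \<open>Z = (s + P)\<^sup>-\<^sup>1 V\<^sup>t\<close>. As \<open>B\<close> and \<open>C\<close> have entries
  \<open>1\<close> and \<open>-1\<close>, an entry of \<open>E\<close> is at most \<open>r\<^sup>2\<close> times the largest entry of \<open>Z\<close>. If \<open>A\<close> is
  Hadamard, then \<open>P = \<surd>r\<close> and the entries of \<open>Z\<close> have modulus \<open>1 / ((s + \<surd>r) \<surd>r)\<close>. In general, if
  \<open>m\<close> bounds the entries of \<open>V - A / s\<close>, then those of \<open>Z\<close> are at most \<open>s m / (N - r\<^sup>2)\<close>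
  (\<open>complement_pattern_of_Pol_bound\<close>), and \<open>N > r\<^sup>2 s m + r\<^sup>2\<close> suffices. The second threshold is the
  solution of this quadratic inequality in \<open>s\<close>, and the third one is the same with \<open>m = 1 + 1 / s\<close>.

  Polar decompositions come from a variational argument in the same spirit: a maximiser of
  \<open>V \<mapsto> A \<bullet> V\<close> on the compact orthogonal group has \<open>V\<^sup>t A\<close> positive semidefinite
  (\<open>psd_if_identity_maximal\<close>).
\<close>

section \<open>Matrix algebra and the Frobenius inner product\<close>

lemma matrix_add_rdistrib:
  fixes A B :: "real^'n^'m" and C :: "real^'k^'n"
  shows "(A + B) ** C = A ** C + B ** C"
  by (vector matrix_matrix_mult_def sum.distrib[symmetric] field_simps)

lemma matrix_diff_ldistrib:
  fixes A :: "real^'n^'m" and B C :: "real^'k^'n"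
  shows "A ** (B - C) = A ** B - A ** C"
  by (vector matrix_matrix_mult_def sum_subtractf[symmetric] field_simps)

lemma matrix_diff_rdistrib:
  fixes A B :: "real^'n^'m" and C :: "real^'k^'n"
  shows "(A - B) ** C = A ** C - B ** C"
  by (vector matrix_matrix_mult_def sum_subtractf[symmetric] field_simps)

lemma scaleR_matrix_mult:
  fixes A :: "real^'n^'m" and B :: "real^'k^'n"
  shows "(k *\<^sub>R A) ** B = k *\<^sub>R (A ** B)"
  by (simp add: scalar_matrix_assoc)

lemma matrix_mult_scaleR:
  fixes A :: "real^'n^'m" and B :: "real^'k^'n"
  shows "A ** (k *\<^sub>R B) = k *\<^sub>R (A ** B)"
  by (simp add: matrix_scalar_ac scaleR_matrix_mult)

lemma matrix_mult_minus:
  fixes A :: "real^'n^'m" and B :: "real^'k^'n"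
  shows "(- A) ** B = - (A ** B)" "A ** (- B) = - (A ** B)"
  using scaleR_matrix_mult[of "-1" A B] matrix_mult_scaleR[of A "-1" B] by simp_all

lemma transpose_add: "transpose (A + B) = transpose A + transpose (B :: real^'n^'m)"
  by (vector transpose_def)

lemma transpose_diff: "transpose (A - B) = transpose A - transpose (B :: real^'n^'m)"
  by (vector transpose_def)

lemma transpose_minus: "transpose (- A) = - transpose (A :: real^'n^'m)"
  by (vector transpose_def)

lemmas matrix_ring_simps =
  matrix_add_ldistrib matrix_add_rdistrib matrix_diff_ldistrib matrix_diff_rdistrib
  scaleR_matrix_mult matrix_mult_scaleR matrix_mult_minus
  transpose_add transpose_diff transpose_minus transpose_scalar matrix_transpose_mul

lemma inner_matrix_sum:
  "M \<bullet> K = (\<Sum>i\<in>UNIV. \<Sum>j\<in>UNIV. M $ i $ j * K $ i $ j)" for M K :: "real^'n^'m"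
  by (simp add: inner_vec_def)

lemma inner_transpose: "transpose M \<bullet> transpose K = M \<bullet> K" for M K :: "real^'n^'m"
  unfolding inner_matrix_sum transpose_def by (simp, subst sum.swap, simp)

text \<open>Multiplication by a matrix and by its transpose are adjoint for the entrywise inner
  product, which is therefore invariant under the orthogonal group. This replaces the cyclicity
  of the trace and also covers rectangular matrices.\<close>

lemma inner_matrix_mult_left: "(M ** X) \<bullet> Y = X \<bullet> (transpose M ** Y)"
  for M :: "real^'n^'m" and X :: "real^'k^'n"
proof -
  have "(M ** X) \<bullet> Y = (\<Sum>i\<in>UNIV. \<Sum>j\<in>UNIV. \<Sum>l\<in>UNIV. M $ i $ l * X $ l $ j * Y $ i $ j)"
    by (simp add: inner_matrix_sum matrix_matrix_mult_def sum_distrib_right)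
  also have "\<dots> = (\<Sum>i\<in>UNIV. \<Sum>l\<in>UNIV. \<Sum>j\<in>UNIV. M $ i $ l * X $ l $ j * Y $ i $ j)"
    by (intro sum.cong refl, rule sum.swap)
  also have "\<dots> = (\<Sum>l\<in>UNIV. \<Sum>i\<in>UNIV. \<Sum>j\<in>UNIV. M $ i $ l * X $ l $ j * Y $ i $ j)"
    by (rule sum.swap)
  also have "\<dots> = (\<Sum>l\<in>UNIV. \<Sum>j\<in>UNIV. \<Sum>i\<in>UNIV. M $ i $ l * X $ l $ j * Y $ i $ j)"
    by (intro sum.cong refl, rule sum.swap)
  also have "\<dots> = X \<bullet> (transpose M ** Y)"
    by (simp add: inner_matrix_sum matrix_matrix_mult_def transpose_def sum_distrib_left mult_ac)
  finally show ?thesis .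
qed

lemma inner_matrix_mult_right: "(X ** M) \<bullet> Y = X \<bullet> (Y ** transpose M)"
  for X :: "real^'n^'m" and M :: "real^'k^'n"
  using inner_matrix_mult_left[of "transpose M" "transpose X" "transpose Y"]
  by (simp add: inner_transpose flip: matrix_transpose_mul)
    (metis inner_transpose matrix_transpose_mul transpose_transpose)

section \<open>Positive semidefinite matrices\<close>

lemma psd_congruence:
  fixes P :: "real^'n^'n" and M :: "real^'k^'n"
  assumes "psd_matrix P"
  shows "psd_matrix (transpose M ** P ** M)"
proof -
  have "v \<bullet> ((transpose M ** P ** M) *v v) = (M *v v) \<bullet> (P *v (M *v v))" for v
    by (metis dot_lmul_matrix inner_commute matrix_vector_mul_assoc transpose_matrix_vector)
  then show ?thesis
    using assms by (simp add: psd_matrix_def matrix_transpose_mul matrix_mul_assoc)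
qed

lemma psd_mat_1: "psd_matrix (mat 1 :: real^'n^'n)"
  by (simp add: psd_matrix_def)

lemma psd_gram: "psd_matrix (transpose M ** M)" for M :: "real^'k^'n"
  using psd_congruence[OF psd_mat_1, of M] by simp

lemma psd_add: "psd_matrix P \<Longrightarrow> psd_matrix Q \<Longrightarrow> psd_matrix (P + Q)" for P :: "real^'n^'n"
  by (simp add: psd_matrix_def transpose_add matrix_vector_mult_add_rdistrib inner_add_right)

lemma psd_scaleR: "psd_matrix P \<Longrightarrow> 0 \<le> k \<Longrightarrow> psd_matrix (k *\<^sub>R P)" for P :: "real^'n^'n"
  by (simp add: psd_matrix_def transpose_scalar flip: scaleR_matrix_vector_assoc)

text \<open>Splitting by columns turns \<open>tr (X\<^sup>t P X)\<close> into a sum of values of the quadratic form of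
  \<open>P\<close>; hence it is nonnegative for semidefinite \<open>P\<close>, and if it vanishes then so does every
  summand.\<close>

lemma inner_matrix_mult_columns:
  "X \<bullet> (P ** X) = (\<Sum>j\<in>UNIV. column j X \<bullet> (P *v column j X))"
  for P :: "real^'n^'n" and X :: "real^'k^'n"
  unfolding inner_matrix_sum
  by (subst sum.swap) (simp add: inner_vec_def matrix_matrix_mult_def matrix_vector_mult_def column_def)

lemma psd_inner_nonneg:
  fixes P :: "real^'n^'n" and X :: "real^'k^'n"
  assumes "psd_matrix P"
  shows "0 \<le> X \<bullet> (P ** X)"
  using assms by (simp add: inner_matrix_mult_columns psd_matrix_def sum_nonneg)

text \<open>First-order conditions at an extremum are extracted below from inequalities between
  polynomials of degree two in a free parameter \<open>t\<close>.\<close>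

lemma zero_if_linear_le_square:
  fixes a K :: real
  assumes "\<And>t. a * t \<le> K * t\<^sup>2"
  shows "a = 0"
proof (rule ccontr)
  assume "a \<noteq> 0"
  define c where "c = 2 * (\<bar>K\<bar> + 1)"
  have c: "c > 0" "K < c" by (auto simp: c_def)
  have "a * (a / c) \<le> K * (a / c)\<^sup>2" using assms .
  then have "a\<^sup>2 * c \<le> a\<^sup>2 * K"
    using c by (simp add: field_simps power2_eq_square)
  then show False using \<open>a \<noteq> 0\<close> c by simp
qed

text \<open>A zero \<open>v\<close> of a nonnegative quadratic form minimises it. Moving from \<open>v\<close> in the direction
  \<open>w = P v\<close> changes the form by \<open>2 t |w|\<^sup>2 + O(t\<^sup>2)\<close>, so \<open>w\<close> must vanish.\<close>

lemma psd_kernel: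
  fixes P :: "real^'n^'n"
  assumes P: "psd_matrix P" and v: "v \<bullet> (P *v v) = 0"
  shows "P *v v = 0"
proof -
  define w where "w = P *v v"
  have sym: "v \<bullet> (P *v w) = w \<bullet> w"
    using P unfolding w_def psd_matrix_def
    by (metis dot_lmul_matrix transpose_matrix_vector)
  have "(-2 * (w \<bullet> w)) * t \<le> (w \<bullet> (P *v w)) * t\<^sup>2" for t
  proof -
    have "0 \<le> (v + t *\<^sub>R w) \<bullet> (P *v (v + t *\<^sub>R w))"
      using P by (simp add: psd_matrix_def)
    also have "\<dots> = 2 * (w \<bullet> w) * t + (w \<bullet> (P *v w)) * t\<^sup>2"
      using sym v
      by (simp add: matrix_vector_right_distrib matrix_vector_mult_scaleR inner_add_left
          inner_add_right w_def[symmetric] inner_commute power2_eq_square algebra_simps)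
    finally show ?thesis by simp
  qed
  then have "-2 * (w \<bullet> w) = 0" by (rule zero_if_linear_le_square)
  then show ?thesis by (simp add: w_def)
qed

lemma psd_inner_eq_0:
  fixes P :: "real^'n^'n" and X :: "real^'k^'n"
  assumes P: "psd_matrix P" and "X \<bullet> (P ** X) = 0"
  shows "P ** X = 0"
proof -
  have "column j X \<bullet> (P *v column j X) = 0" for j
    using assms by (simp add: inner_matrix_mult_columns psd_matrix_def sum_nonneg_eq_0_iff)
  then have "P *v column j X = 0" for j using psd_kernel[OF P] by blast
  then show ?thesis
    by (simp add: vec_eq_iff matrix_matrix_mult_def matrix_vector_mult_def column_def)
qed

text \<open>With \<open>X = P - Q\<close> the equality of the squares reads
  \<open>P X + X Q = 0\<close>. Pairing this with \<open>X\<close> gives two nonnegative numbers of sum zero, hence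
  \<open>P X = Q X = 0\<close>, and so \<open>X\<^sup>t X = (P - Q) X = 0\<close>.\<close>

lemma psd_sqrt_unique:
  fixes P Q :: "real^'n^'n"
  assumes P: "psd_matrix P" and Q: "psd_matrix Q" and eq: "P ** P = Q ** Q"
  shows "P = Q"
proof -
  define X where "X = P - Q"
  have tX: "transpose X = X"
    using P Q by (simp add: X_def transpose_diff psd_matrix_def)
  have PXQ: "P ** X = - (X ** Q)"
    by (simp add: X_def matrix_ring_simps eq)
  have "X \<bullet> (P ** X) = - (X \<bullet> (X ** Q))" by (simp add: PXQ)
  also have "X \<bullet> (X ** Q) = X \<bullet> (Q ** X)"
    using inner_transpose[of X "X ** Q"] Q
    by (simp add: matrix_transpose_mul tX psd_matrix_def)
  finally have "X \<bullet> (P ** X) + X \<bullet> (Q ** X) = 0" by simp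
  then have "X \<bullet> (P ** X) = 0" "X \<bullet> (Q ** X) = 0"
    using psd_inner_nonneg[OF P, of X] psd_inner_nonneg[OF Q, of X] by linarith+
  then have "P ** X = 0" "Q ** X = 0"
    using psd_inner_eq_0 P Q by blast+
  moreover have "transpose X ** X = P ** X - Q ** X"
    unfolding tX by (subst (1) X_def) (rule matrix_diff_rdistrib)
  ultimately have "transpose X ** X = 0" by simp
  then have "X \<bullet> X = 0"
    using inner_matrix_mult_left[of X "mat 1" X] by simp
  then show ?thesis by (simp add: X_def)
qed

section \<open>Polar decomposition by maximising over the orthogonal group\<close>

text \<open>This is the nonnegativity of \<open>tr ((1 - Q) P (1 - Q)\<^sup>t)\<close>, expanded using \<open>Q\<^sup>t Q = 1\<close>: the
  value is \<open>2 tr P - 2 tr (P\<^sup>t Q)\<close>.\<close>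

lemma inner_orthogonal_le:
  fixes P Q :: "real^'n^'n"
  assumes P: "psd_matrix P" and Q: "orthogonal_matrix Q"
  shows "P \<bullet> Q \<le> P \<bullet> mat 1"
proof -
  have tP: "transpose P = P" using P by (simp add: psd_matrix_def)
  have QQ: "transpose Q ** Q = mat 1" "Q ** transpose Q = mat 1"
    using Q by (auto simp: orthogonal_matrix_def)
  let ?X = "mat 1 - transpose Q"
  have "mat 1 \<bullet> (P ** transpose Q) = P \<bullet> Q"
    using inner_matrix_mult_right[of "mat 1" Q P] by (simp add: inner_commute)
  moreover have "transpose Q \<bullet> P = P \<bullet> Q"
    using inner_transpose[of Q P] by (simp add: tP inner_commute)
  moreover have "transpose Q \<bullet> (P ** transpose Q) = P \<bullet> mat 1"
    using inner_matrix_mult_right[of "transpose Q" Q P] by (simp add: QQ inner_commute)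
  ultimately have "?X \<bullet> (P ** ?X) = 2 * (P \<bullet> mat 1) - 2 * (P \<bullet> Q)"
    by (simp add: matrix_diff_ldistrib inner_diff_left inner_diff_right inner_commute)
  with psd_inner_nonneg[OF P, of ?X] show ?thesis by simp
qed

definition outer :: "real^'n \<Rightarrow> real^'n \<Rightarrow> real^'n^'n" where
  "outer u v = (\<chi> i j. u $ i * v $ j)"

lemma transpose_outer: "transpose (outer u v) = outer v u"
  by (simp add: outer_def transpose_def mult.commute)

lemma outer_mult_outer: "outer u v ** outer w z = (v \<bullet> w) *\<^sub>R outer u z"
  by (simp add: vec_eq_iff outer_def matrix_matrix_mult_def inner_vec_def sum_distrib_left
      sum_distrib_right mult_ac)

lemma inner_outer: "P \<bullet> outer u v = u \<bullet> (P *v v)"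
  by (simp add: inner_matrix_sum outer_def inner_vec_def matrix_vector_mult_def
      sum_distrib_left mult_ac)

definition reflection :: "real^'n \<Rightarrow> real^'n^'n" where
  "reflection u = mat 1 - (2 / (u \<bullet> u)) *\<^sub>R outer u u"

text \<open>For \<open>u = 0\<close> the division by zero makes the reflection the identity.\<close>

lemma orthogonal_reflection: "orthogonal_matrix (reflection u)"
  by (simp add: orthogonal_matrix reflection_def matrix_ring_simps transpose_outer
      outer_mult_outer) (auto simp: vec_eq_iff field_simps)

text \<open>The converse of \<open>inner_orthogonal_le\<close>, and the source of polar decompositions. Testing a
  single reflection in \<open>u\<close> shows that \<open>q(u,u) = u \<bullet> P u\<close> is nonnegative. Testing the product of the
  reflections in \<open>u\<close> and in a nearby vector \<open>u + t v\<close>, which is a small rotation, gives an inequality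
  whose first-order part in \<open>t\<close> is proportional to \<open>q(u,v) - q(v,u)\<close>; so \<open>P\<close> is symmetric.\<close>

lemma psd_if_identity_maximal:
  fixes P :: "real^'n^'n"
  assumes max: "\<And>Q. orthogonal_matrix Q \<Longrightarrow> P \<bullet> Q \<le> P \<bullet> mat 1"
  shows "psd_matrix P"
proof -
  define q where "q u v = u \<bullet> (P *v v)" for u v
  \<comment> \<open>Homogeneous form of the test with two reflections, valid also for zero vectors.\<close>
  have two: "2 * (u \<bullet> v) * q u v \<le> (v \<bullet> v) * q u u + (u \<bullet> u) * q v v" for u v
  proof (cases "u = 0 \<or> v = 0")
    case True
    then show ?thesis by (auto simp: q_def)
  next
    case False
    define a b where "a = u \<bullet> u" and "b = v \<bullet> v"
    have pos: "a > 0" "b > 0" using False by (auto simp: a_def b_def)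
    have "P \<bullet> (reflection u ** reflection v) \<le> P \<bullet> mat 1"
      by (intro max orthogonal_matrix_mul orthogonal_reflection)
    then have "4 / (a * b) * (u \<bullet> v) * q u v \<le> 2 / a * q u u + 2 / b * q v v"
      by (simp add: reflection_def matrix_ring_simps outer_mult_outer inner_diff_right
          inner_outer q_def a_def b_def algebra_simps)
    then have "a * b / 2 * (4 / (a * b) * (u \<bullet> v) * q u v)
        \<le> a * b / 2 * (2 / a * q u u + 2 / b * q v v)"
      using pos by (intro mult_left_mono) auto
    also have "a * b / 2 * (4 / (a * b) * (u \<bullet> v) * q u v) = 2 * (u \<bullet> v) * q u v"
      using pos by simp
    also have "a * b / 2 * (2 / a * q u u + 2 / b * q v v) = b * q u u + a * q v v"
      using pos by (simp add: field_simps)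
    finally show ?thesis by (simp add: a_def b_def)
  qed
  have pos: "0 \<le> q u u" for u
  proof (cases "u = 0")
    case False
    have "P \<bullet> reflection u \<le> P \<bullet> mat 1" by (intro max orthogonal_reflection)
    then have "0 \<le> 2 / (u \<bullet> u) * q u u"
      by (simp add: reflection_def inner_diff_right inner_outer q_def)
    moreover have "0 < 2 / (u \<bullet> u)" using False by simp
    ultimately show ?thesis by (metis linorder_not_le mult_pos_neg)
  qed (simp add: q_def)
  have sym: "q u v = q v u" for u v
  proof (cases "u = 0")
    case False
    have bil: "q (u + t *\<^sub>R v) w = q u w + t * q v w" "q w (u + t *\<^sub>R v) = q w u + t * q w v" for t w
      by (simp_all add: q_def matrix_vector_right_distrib matrix_vector_mult_scaleR
          inner_add_left inner_add_right)
    \<comment> \<open>In \<open>two\<close> at \<open>u + t v\<close> the constant terms and the multiples of \<open>u \<bullet> v\<close> cancel to first order.\<close>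
    have "((u \<bullet> u) * (q u v - q v u)) * t
        \<le> ((v \<bullet> v) * q u u + (u \<bullet> u) * q v v - 2 * (u \<bullet> v) * q u v) * t\<^sup>2" for t
      using two[of u "u + t *\<^sub>R v"]
      by (simp add: bil inner_add_left inner_add_right inner_commute[of v u] power2_eq_square
          algebra_simps)
    then have "(u \<bullet> u) * (q u v - q v u) = 0" by (rule zero_if_linear_le_square)
    then show ?thesis using False by simp
  qed (simp add: q_def)
  have "P $ i $ j = q (axis i 1) (axis j 1)" for i j
    by (simp add: q_def matrix_vector_mul_component inner_axis' inner_axis)
  then have "transpose P = P"
    using sym by (simp add: vec_eq_iff transpose_def)
  then show ?thesis using pos by (simp add: psd_matrix_def q_def)
qed

lemma compact_orthogonal_group: "compact {V :: real^'n^'n. orthogonal_matrix V}"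
proof -
  have "norm V = norm (mat 1 :: real^'n^'n)" if "orthogonal_matrix V" for V :: "real^'n^'n"
    using that inner_matrix_mult_left[of V "mat 1" V]
    by (simp add: orthogonal_matrix_def norm_eq_sqrt_inner)
  then have "bounded {V :: real^'n^'n. orthogonal_matrix V}"
    by (auto intro!: boundedI)
  moreover have "closed {V :: real^'n^'n. orthogonal_matrix V}"
    unfolding orthogonal_matrix matrix_matrix_mult_def transpose_def
    by (intro closed_Collect_eq continuous_intros)
  ultimately show ?thesis by (simp add: compact_eq_bounded_closed)
qed

text \<open>The orthogonal factor is found as a point of the compact orthogonal group closest to \<open>A\<close>,
  that is, one maximising the inner product with \<open>A\<close>. Translating the maximum to the identity,
  the remaining factor \<open>V\<^sup>t A\<close> is semidefinite by \<open>psd_if_identity_maximal\<close>.\<close>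

lemma polar_decomposition_exists:
  fixes A :: "real^'n^'n"
  obtains V P where "orthogonal_matrix V" "psd_matrix P" "A = V ** P"
proof -
  have "\<exists>V\<in>{V :: real^'n^'n. orthogonal_matrix V}. \<forall>Y\<in>{V. orthogonal_matrix V}. A \<bullet> Y \<le> A \<bullet> V"
    by (rule continuous_attains_sup)
      (auto intro!: compact_orthogonal_group continuous_intros orthogonal_matrix_id)
  then obtain V :: "real^'n^'n" where V: "orthogonal_matrix V"
    and max: "\<And>Y. orthogonal_matrix Y \<Longrightarrow> A \<bullet> Y \<le> A \<bullet> V" by blast
  have "psd_matrix (transpose V ** A)"
  proof (rule psd_if_identity_maximal)
    fix Q :: "real^'n^'n"
    assume "orthogonal_matrix Q"
    then have "A \<bullet> (V ** Q) \<le> A \<bullet> V" by (intro max orthogonal_matrix_mul V)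
    then show "(transpose V ** A) \<bullet> Q \<le> (transpose V ** A) \<bullet> mat 1"
      by (simp add: inner_matrix_mult_left)
  qed
  moreover have "A = V ** (transpose V ** A)"
    using V by (simp add: matrix_mul_assoc orthogonal_matrix_def)
  ultimately show thesis using V that by blast
qed

lemma polar_gram:
  fixes A V P :: "real^'n^'n"
  assumes V: "orthogonal_matrix V" and P: "psd_matrix P" and AVP: "A = V ** P"
  shows "transpose A ** A = P ** P"
proof -
  have "transpose A ** A = P ** (transpose V ** V) ** P"
    using P by (simp add: AVP matrix_transpose_mul matrix_mul_assoc psd_matrix_def)
  then show ?thesis using V by (simp add: orthogonal_matrix_def)
qed

text \<open>Any polar decomposition computes \<open>Pol\<close>: its semidefinite factor is the unique square root
  of the Gram matrix, and for invertible \<open>A\<close> that factor can be cancelled.\<close>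

lemma Pol_eq:
  fixes A :: "real^'n^'n"
  assumes A: "invertible A" and V: "orthogonal_matrix V" and P: "psd_matrix P"
    and AVP: "A = V ** P"
  shows "Pol A = V"
proof -
  note AA = polar_gram[OF V P AVP]
  have sqrt: "matrix_sqrt (transpose A ** A) = P"
    unfolding matrix_sqrt_def AA
    by (rule the_equality) (auto simp: P intro: psd_sqrt_unique)
  have "P = transpose V ** A"
    using V by (simp add: AVP matrix_mul_assoc orthogonal_matrix_def)
  moreover have "invertible (transpose V)"
    using V by (auto simp: orthogonal_matrix_def invertible_def)
  ultimately have "invertible P" using A by (simp add: invertible_mult)
  then obtain R where R: "P ** R = mat 1" by (auto simp: invertible_def)
  show ?thesis unfolding Pol_def sqrt
  proof (rule the_equality)
    fix V' assume "orthogonal_matrix V' \<and> A = V' ** P"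
    then have "V' ** P ** R = V ** P ** R" using AVP by simp
    then show "V' = V" by (simp add: R flip: matrix_mul_assoc)
  qed (use V AVP in simp)
qed

section \<open>Local maxima of the 1-norm\<close>

lemma pm1_cases: "S $ i $ j = -1 \<or> S $ i $ j = 1" if "pm1_matrix S"
  using that by (auto simp: pm1_matrix_def)

lemma pm1_abs: "\<bar>S $ i $ j\<bar> = 1" if "pm1_matrix S"
  using pm1_cases[OF that, of i j] by auto

text \<open>Replacing \<open>V\<close> by \<open>W\<^sup>t V\<close> moves \<open>W\<close> to the identity and \<open>S\<close> to the semidefinite \<open>W\<^sup>t S\<close>, for which
  the identity is maximal.\<close>

lemma inner_le_if_psd:
  fixes S V W :: "real^'n^'n"
  assumes W: "orthogonal_matrix W" and V: "orthogonal_matrix V"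
    and psd: "psd_matrix (transpose W ** S)"
  shows "S \<bullet> V \<le> S \<bullet> W"
proof -
  have WW: "W ** transpose W = mat 1" using W by (simp add: orthogonal_matrix_def)
  have "S \<bullet> V = (transpose W ** S) \<bullet> (transpose W ** V)"
    using inner_matrix_mult_left[of W "transpose W ** V" S]
    by (simp add: WW matrix_mul_assoc inner_commute)
  also have "\<dots> \<le> (transpose W ** S) \<bullet> mat 1"
    using V W by (intro inner_orthogonal_le psd orthogonal_matrix_mul) auto
  also have "\<dots> = S \<bullet> W" by (simp add: inner_matrix_mult_left)
  finally show ?thesis .
qed

text \<open>Since \<open>W\<close> has no zero entry, every matrix near \<open>W\<close> has the sign pattern \<open>S\<close> too. On such
  matrices the 1-norm is the linear functional \<open>V \<mapsto> S \<bullet> V\<close>, which \<open>W\<close> maximises over the whole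
  orthogonal group.\<close>

lemma local_max_one_norm:
  fixes S W :: "real^'n^'n"
  assumes W: "orthogonal_matrix W" and psd: "psd_matrix (transpose W ** S)"
    and S: "pm1_matrix S" and pos: "\<And>i j. 0 < S $ i $ j * W $ i $ j"
  shows "local_max_on entry_one_norm {V. orthogonal_matrix V} W"
proof -
  let ?F = "at W within {V. orthogonal_matrix V}"
  have norm: "entry_one_norm V = S \<bullet> V" if "\<And>i j. 0 < S $ i $ j * V $ i $ j" for V
  proof -
    have "\<bar>V $ i $ j\<bar> = S $ i $ j * V $ i $ j" for i j
      using pm1_cases[OF S, of i j] that[of i j] by auto
    then show ?thesis by (simp add: entry_one_norm_def inner_matrix_sum)
  qed
  have "\<forall>\<^sub>F V in ?F. 0 < S $ i $ j * V $ i $ j" for i j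
    by (rule order_tendstoD(1)[OF _ pos[of i j]]) (intro tendsto_intros)
  then have "\<forall>\<^sub>F V in ?F. \<forall>i j. 0 < S $ i $ j * V $ i $ j"
    by (simp add: eventually_all_finite)
  moreover have "\<forall>\<^sub>F V in ?F. orthogonal_matrix V"
    by (simp add: eventually_at_filter)
  ultimately have "\<forall>\<^sub>F V in ?F. entry_one_norm V \<le> entry_one_norm W"
  proof eventually_elim
    case (elim V)
    then show ?case using norm[of V] norm[of W] pos inner_le_if_psd[OF W _ psd, of V] by simp
  qed
  then show ?thesis using W by (simp add: local_max_on_def)
qed

lemma almost_hadamard_pattern_if_psd:
  fixes S W :: "real^'n^'n"
  assumes W: "orthogonal_matrix W" and psd: "psd_matrix (transpose W ** S)"
    and S: "pm1_matrix S" and pos: "\<And>i j. 0 < S $ i $ j * W $ i $ j"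
  shows "almost_hadamard_pattern S"
proof -
  let ?n = "sqrt (real CARD('n))"
  have n: "?n > 0" by simp
  have "S $ i $ j = sgn ((?n *\<^sub>R W) $ i $ j)" for i j
    using pm1_cases[OF S, of i j] pos[of i j] n by (auto simp: sgn_mult)
  moreover have "almost_hadamard_matrix (?n *\<^sub>R W)"
    unfolding almost_hadamard_matrix_def using local_max_one_norm[OF assms] n by simp
  ultimately show ?thesis using S unfolding almost_hadamard_pattern_def by blast
qed

section \<open>The complementary block\<close>

text \<open>The matrix \<open>W\<close> is an explicit candidate for \<open>Pol D\<close>, with \<open>Z = (s + P)\<^sup>-\<^sup>1 V\<^sup>t\<close>. The block
  relations replace \<open>C\<^sup>t C\<close> by \<open>s\<^sup>2 - P\<^sup>2 = (s - P)(s + P)\<close> and \<open>C\<^sup>t D\<close> by \<open>-P V\<^sup>t B\<close>; this cancels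
  the resolvents, and all terms that remain are expressed through the symmetric matrix
  \<open>Y = V (s + P)\<^sup>-\<^sup>1 V\<^sup>t\<close>. The products with the error term \<open>E = C Z B\<close> then add up to \<open>B\<^sup>t B\<close>, which
  completes \<open>D\<^sup>t D\<close> to \<open>s\<^sup>2\<close>. For the second claim, \<open>s W\<^sup>t D\<close> is \<open>D\<^sup>t D\<close> plus a congruent copy of
  \<open>s P + P\<^sup>2\<close>.\<close>

lemma complement_orthogonal_psd:
  fixes A V P Z :: "real^'r^'r" and B :: "real^'d^'r" and C :: "real^'r^'d" and D :: "real^'d^'d"
  assumes AC: "transpose A ** A + transpose C ** C = s\<^sup>2 *\<^sub>R mat 1"
    and off: "transpose A ** B + transpose C ** D = 0"
    and BD: "transpose B ** B + transpose D ** D = s\<^sup>2 *\<^sub>R mat 1"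
    and V: "orthogonal_matrix V" and P: "psd_matrix P" and AVP: "A = V ** P"
    and Z: "(s *\<^sub>R mat 1 + P) ** Z = transpose V" and s: "s > 0"
  defines "W \<equiv> (1 / s) *\<^sub>R (D - C ** Z ** B)"
  shows "orthogonal_matrix W" "psd_matrix (transpose W ** D)"
proof -
  have tP: "transpose P = P" using P by (simp add: psd_matrix_def)
  have VV: "transpose V ** V = mat 1" "V ** transpose V = mat 1"
    using V by (auto simp: orthogonal_matrix_def)
  have tA: "transpose A = P ** transpose V" by (simp add: AVP matrix_transpose_mul tP)
  have PZ: "P ** Z = transpose V - s *\<^sub>R Z"
    using Z by (simp add: matrix_ring_simps algebra_simps)
  note AA = polar_gram[OF V P AVP]
  have CC: "transpose C ** C = s\<^sup>2 *\<^sub>R mat 1 - P ** P"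
    using AC by (simp add: AA algebra_simps)
  define Y where "Y = transpose Z ** transpose V"
  have Y: "Y = s *\<^sub>R (transpose Z ** Z) + transpose Z ** P ** Z"
    unfolding Y_def by (simp add: Z[symmetric] matrix_ring_simps matrix_mul_assoc)
  have tY: "transpose Y = Y"
    by (simp add: Y matrix_ring_simps tP matrix_mul_assoc)
  have VZ: "V ** Z = Y" using tY by (simp add: Y_def matrix_transpose_mul)
  have VPZ: "V ** P ** Z = mat 1 - s *\<^sub>R Y"
    by (simp add: matrix_mul_assoc[symmetric] PZ matrix_ring_simps VV VZ)
  have ZPV: "transpose Z ** P ** transpose V = mat 1 - s *\<^sub>R Y"
    using arg_cong[OF VPZ, of transpose] by (simp add: matrix_ring_simps tP tY matrix_mul_assoc)
  have CCZ: "transpose C ** C ** Z = s *\<^sub>R transpose V - P ** transpose V"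
  proof -
    have "P ** P ** Z = P ** transpose V - s *\<^sub>R (transpose V - s *\<^sub>R Z)"
      by (simp add: matrix_mul_assoc[symmetric] PZ matrix_ring_simps)
    then show ?thesis
      by (simp add: CC matrix_ring_simps power2_eq_square algebra_simps)
  qed
  have ZCCZ: "transpose Z ** transpose C ** C ** Z = (2 * s) *\<^sub>R Y - mat 1"
  proof -
    have "transpose Z ** transpose C ** C ** Z = transpose Z ** (transpose C ** C ** Z)"
      by (simp add: matrix_mul_assoc)
    also have "\<dots> = s *\<^sub>R Y - transpose Z ** P ** transpose V"
      by (simp add: CCZ matrix_ring_simps Y_def matrix_mul_assoc)
    also have "\<dots> = (2 * s) *\<^sub>R Y - mat 1"
      unfolding ZPV by (simp add: algebra_simps flip: scaleR_add_left)
    finally show ?thesis .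
  qed
  define E where "E = C ** Z ** B"
  have CD: "transpose C ** D = - (P ** transpose V ** B)"
    using off by (simp add: tA add_eq_0_iff)
  have ED: "transpose E ** D = - (transpose B ** (transpose Z ** P ** transpose V) ** B)"
  proof -
    have "transpose E ** D = transpose B ** transpose Z ** (transpose C ** D)"
      by (simp add: E_def matrix_transpose_mul matrix_mul_assoc)
    then show ?thesis by (simp add: CD matrix_ring_simps matrix_mul_assoc)
  qed
  have DE: "transpose D ** E = - (transpose B ** (V ** P ** Z) ** B)"
    using arg_cong[OF ED, of transpose] by (simp add: matrix_ring_simps tP matrix_mul_assoc)
  have EE: "transpose E ** E = transpose B ** (transpose Z ** transpose C ** C ** Z) ** B"
    by (simp add: E_def matrix_transpose_mul matrix_mul_assoc)
  have "transpose (D - E) ** (D - E) = s\<^sup>2 *\<^sub>R mat 1"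
  proof -
    have "transpose (D - E) ** (D - E) =
        transpose D ** D - transpose D ** E - transpose E ** D + transpose E ** E"
      by (simp add: matrix_ring_simps)
    also have "\<dots> = transpose D ** D + transpose B **
        ((mat 1 - s *\<^sub>R Y) + (mat 1 - s *\<^sub>R Y) + ((2 * s) *\<^sub>R Y - mat 1)) ** B"
      unfolding ED DE EE VPZ ZPV ZCCZ by (simp only: matrix_ring_simps) simp
    also have "(mat 1 - s *\<^sub>R Y) + (mat 1 - s *\<^sub>R Y) + ((2 * s) *\<^sub>R Y - mat 1) = mat 1"
      by (simp add: vec_eq_iff)
    also have "transpose D ** D + transpose B ** mat 1 ** B = s\<^sup>2 *\<^sub>R mat 1"
      using BD by (simp add: add.commute)
    finally show ?thesis .
  qed
  then show "orthogonal_matrix W"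
    using s by (simp add: orthogonal_matrix W_def E_def[symmetric] transpose_scalar
        scaleR_matrix_mult matrix_mult_scaleR power2_eq_square)
  have "transpose Z ** P ** transpose V = s *\<^sub>R (transpose Z ** P ** Z)
      + transpose (P ** Z) ** (P ** Z)"
    by (simp add: Z[symmetric] matrix_ring_simps tP matrix_mul_assoc)
  then have "psd_matrix (transpose Z ** P ** transpose V)"
    using s by (simp add: psd_add psd_scaleR psd_congruence P psd_gram)
  then have "psd_matrix (transpose D ** D + transpose B ** (transpose Z ** P ** transpose V) ** B)"
    by (intro psd_add psd_gram psd_congruence)
  moreover have "transpose W ** D = (1 / s) *\<^sub>R
      (transpose D ** D + transpose B ** (transpose Z ** P ** transpose V) ** B)"
    unfolding W_def E_def[symmetric] using ED
    by (simp only: transpose_scalar scaleR_matrix_mult transpose_diff matrix_diff_rdistrib) simp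
  ultimately show "psd_matrix (transpose W ** D)" using s by (simp add: psd_scaleR)
qed

lemma abs_sandwich_le:
  fixes B :: "real^'d^'r" and C :: "real^'r^'m" and Z :: "real^'r^'r"
  assumes B: "\<And>i j. \<bar>B $ i $ j\<bar> \<le> 1" and C: "\<And>i j. \<bar>C $ i $ j\<bar> \<le> 1"
    and Z: "\<And>i j. \<bar>Z $ i $ j\<bar> \<le> z"
  shows "\<bar>(C ** Z ** B) $ i $ j\<bar> \<le> (real CARD('r))\<^sup>2 * z"
proof -
  have "\<bar>(C ** Z ** B) $ i $ j\<bar> = \<bar>\<Sum>l\<in>UNIV. \<Sum>k\<in>UNIV. C $ i $ k * Z $ k $ l * B $ l $ j\<bar>"
    by (simp add: matrix_matrix_mult_def sum_distrib_right)
  also have "\<dots> \<le> (\<Sum>l\<in>(UNIV::'r set). \<Sum>k\<in>(UNIV::'r set). z)"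
  proof (intro order_trans[OF sum_abs] sum_mono)
    fix k l
    have "\<bar>C $ i $ k\<bar> * \<bar>Z $ k $ l\<bar> * \<bar>B $ l $ j\<bar> \<le> 1 * z * 1"
      using order_trans[OF abs_ge_zero Z[of k l]]
      by (intro mult_mono B C Z) auto
    then show "\<bar>C $ i $ k * Z $ k $ l * B $ l $ j\<bar> \<le> z" by (simp add: abs_mult)
  qed
  also have "\<dots> = (real CARD('r))\<^sup>2 * z" by (simp add: power2_eq_square)
  finally show ?thesis .
qed

text \<open>The error term moves each entry of \<open>D\<close>, which is \<open>1\<close> or \<open>-1\<close>, by less than one, so the
  signs of the matrix \<open>W\<close> of \<open>complement_orthogonal_psd\<close> are those of \<open>D\<close>.\<close>

lemma complement_pattern:
  fixes A V P Z :: "real^'r^'r" and B :: "real^'d^'r" and C :: "real^'r^'d" and D :: "real^'d^'d"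
  assumes AC: "transpose A ** A + transpose C ** C = s\<^sup>2 *\<^sub>R mat 1"
    and off: "transpose A ** B + transpose C ** D = 0"
    and BD: "transpose B ** B + transpose D ** D = s\<^sup>2 *\<^sub>R mat 1"
    and pm: "pm1_matrix B" "pm1_matrix C" "pm1_matrix D"
    and V: "orthogonal_matrix V" and P: "psd_matrix P" and AVP: "A = V ** P"
    and Z: "(s *\<^sub>R mat 1 + P) ** Z = transpose V" and s: "s > 0"
    and z: "\<And>i j. \<bar>Z $ i $ j\<bar> \<le> z" and small: "(real CARD('r))\<^sup>2 * z < 1"
  shows "almost_hadamard_pattern D"
proof -
  let ?E = "C ** Z ** B"
  have pm': "\<bar>B $ i $ j\<bar> \<le> 1" "\<bar>C $ j' $ i\<bar> \<le> 1" for i j j'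
    using pm by (simp_all add: pm1_abs)
  have "0 < D $ i $ j * ((1 / s) *\<^sub>R (D - ?E)) $ i $ j" for i j
  proof -
    have "\<bar>?E $ i $ j\<bar> < 1" using abs_sandwich_le[OF pm' z, of i j] small by linarith
    moreover note pm1_cases[OF pm(3), of i j]
    ultimately show ?thesis using s by (auto simp: field_simps)
  qed
  then show ?thesis
    using complement_orthogonal_psd[OF AC off BD V P AVP Z s] pm(3)
    by (intro almost_hadamard_pattern_if_psd)
qed

lemma scaled_identity_plus_psd_solvable:
  fixes P V :: "real^'n^'n"
  assumes P: "psd_matrix P" and s: "s > 0"
  obtains Z where "(s *\<^sub>R mat 1 + P) ** Z = transpose V"
proof -
  have "x = 0" if "(s *\<^sub>R mat 1 + P) *v x = 0" for x
  proof -
    have "0 = x \<bullet> ((s *\<^sub>R mat 1 + P) *v x)" using that by simp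
    also have "\<dots> = s * (x \<bullet> x) + x \<bullet> (P *v x)"
      by (simp add: matrix_vector_mult_add_rdistrib inner_add_right flip: scaleR_matrix_vector_assoc)
    finally have "s * (x \<bullet> x) \<le> 0"
      using P unfolding psd_matrix_def by (metis add_increasing2 linorder_linear)
    then have "x \<bullet> x \<le> 0" using s by (simp add: mult_le_0_iff)
    then show ?thesis by (metis inner_eq_zero_iff inner_ge_zero order_antisym)
  qed
  then obtain R where "(s *\<^sub>R mat 1 + P) ** R = mat 1"
    by (metis matrix_left_invertible_ker matrix_left_right_inverse)
  then have "(s *\<^sub>R mat 1 + P) ** (R ** transpose V) = transpose V"
    by (simp add: matrix_mul_assoc)
  then show thesis using that by blast
qed

text \<open>It remains to bound the largest entry \<open>z\<close> of \<open>Z\<close>. Multiplying the equation of \<open>Z\<close> by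
  \<open>s - P\<close> gives \<open>s\<^sup>2 Z = (s V - A)\<^sup>t + A\<^sup>t A Z\<close>. The matrix \<open>A\<^sup>t A\<close> has entries at most \<open>r\<close>, so the
  last term is at most \<open>r\<^sup>2 z\<close>. Evaluating at the position of the largest entry gives
  \<open>(s\<^sup>2 - r\<^sup>2) z \<le> s m\<close>.
  The threshold is exactly what makes this bound give \<open>r\<^sup>2 z < 1\<close>.\<close>

lemma complement_pattern_of_Pol_bound:
  fixes A V P :: "real^'r^'r" and B :: "real^'d^'r" and C :: "real^'r^'d" and D :: "real^'d^'d"
  assumes AC: "transpose A ** A + transpose C ** C = s\<^sup>2 *\<^sub>R mat 1"
    and off: "transpose A ** B + transpose C ** D = 0"
    and BD: "transpose B ** B + transpose D ** D = s\<^sup>2 *\<^sub>R mat 1"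
    and pm: "pm1_matrix A" "pm1_matrix B" "pm1_matrix C" "pm1_matrix D"
    and V: "orthogonal_matrix V" and P: "psd_matrix P" and AVP: "A = V ** P"
    and s: "s > 0"
    and m: "\<And>i j. \<bar>(V - (1 / s) *\<^sub>R A) $ i $ j\<bar> \<le> m"
    and big: "s\<^sup>2 > (real CARD('r))\<^sup>2 * s * m + (real CARD('r))\<^sup>2"
  shows "almost_hadamard_pattern D"
proof -
  obtain Z where Z: "(s *\<^sub>R mat 1 + P) ** Z = transpose V"
    using scaled_identity_plus_psd_solvable[OF P s] by blast
  let ?r = "real CARD('r)"
  define z where "z = Max (range (\<lambda>(i, j). \<bar>Z $ i $ j\<bar>))"
  have z: "\<bar>Z $ i $ j\<bar> \<le> z" for i j
    unfolding z_def by (rule Max_ge) auto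
  have "z \<in> range (\<lambda>(i, j). \<bar>Z $ i $ j\<bar>)"
    unfolding z_def by (rule Max_in) auto
  then obtain i j where ij: "z = \<bar>Z $ i $ j\<bar>" by auto
  have m0: "m \<ge> 0" using order_trans[OF abs_ge_zero m] .
  have tA: "transpose A = P ** transpose V"
    using P by (simp add: AVP matrix_transpose_mul psd_matrix_def)
  note AA = polar_gram[OF V P AVP]
  have "s\<^sup>2 *\<^sub>R Z = s *\<^sub>R transpose (V - (1 / s) *\<^sub>R A) + transpose A ** A ** Z"
  proof -
    have PZ: "P ** Z = transpose V - s *\<^sub>R Z"
      using Z by (simp add: matrix_ring_simps algebra_simps)
    have "P ** P ** Z = P ** transpose V - s *\<^sub>R (transpose V - s *\<^sub>R Z)"
      by (simp add: matrix_mul_assoc[symmetric] PZ matrix_ring_simps)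
    then show ?thesis
      using s unfolding AA by (simp add: tA matrix_ring_simps power2_eq_square algebra_simps)
  qed
  then have eq: "s\<^sup>2 * Z $ i $ j = s * (V - (1 / s) *\<^sub>R A) $ j $ i + (transpose A ** A ** Z) $ i $ j"
    by (simp add: vec_eq_iff transpose_def)
  have "s\<^sup>2 * z = \<bar>s\<^sup>2 * Z $ i $ j\<bar>" by (simp add: ij abs_mult)
  also have "\<dots> \<le> \<bar>s * (V - (1 / s) *\<^sub>R A) $ j $ i\<bar> + \<bar>(transpose A ** A ** Z) $ i $ j\<bar>"
    unfolding eq by (rule abs_triangle_ineq)
  also have "\<dots> = s * \<bar>(V - (1 / s) *\<^sub>R A) $ j $ i\<bar> + \<bar>(transpose A ** A ** Z) $ i $ j\<bar>"
    unfolding abs_mult abs_of_pos[OF s] ..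
  also have "\<dots> \<le> s * m + ?r\<^sup>2 * z"
  proof (intro add_mono mult_left_mono m)
    have A1: "\<bar>A $ k $ l\<bar> \<le> 1" for k l
      using pm(1) by (simp add: pm1_abs)
    have "\<bar>(transpose A ** A ** Z) $ i $ j\<bar>
        = \<bar>\<Sum>k\<in>UNIV. \<Sum>l\<in>UNIV. A $ l $ i * A $ l $ k * Z $ k $ j\<bar>"
      by (simp add: matrix_matrix_mult_def transpose_def sum_distrib_right)
    also have "\<dots> \<le> (\<Sum>k\<in>(UNIV::'r set). \<Sum>l\<in>(UNIV::'r set). z)"
    proof (intro order_trans[OF sum_abs] sum_mono)
      fix k l
      have "\<bar>A $ l $ i\<bar> * \<bar>A $ l $ k\<bar> * \<bar>Z $ k $ j\<bar> \<le> 1 * 1 * z"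
        by (intro mult_mono A1 z) auto
      then show "\<bar>A $ l $ i * A $ l $ k * Z $ k $ j\<bar> \<le> z" by (simp add: abs_mult)
    qed
    also have "\<dots> = ?r\<^sup>2 * z" by (simp add: power2_eq_square)
    finally show "\<bar>(transpose A ** A ** Z) $ i $ j\<bar> \<le> ?r\<^sup>2 * z" .
  qed (use s in simp)
  finally have "(s\<^sup>2 - ?r\<^sup>2) * z \<le> s * m" by (simp add: algebra_simps)
  then have "?r\<^sup>2 * ((s\<^sup>2 - ?r\<^sup>2) * z) \<le> ?r\<^sup>2 * (s * m)" by (intro mult_left_mono) auto
  also have "\<dots> < s\<^sup>2 - ?r\<^sup>2" using big by (simp add: algebra_simps)
  finally have "(s\<^sup>2 - ?r\<^sup>2) * (?r\<^sup>2 * z) < (s\<^sup>2 - ?r\<^sup>2) * 1" by (simp add: algebra_simps)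
  moreover have "0 < s\<^sup>2 - ?r\<^sup>2"
  proof -
    have "0 \<le> ?r\<^sup>2 * s * m" using s m0 by simp
    then show ?thesis using big by linarith
  qed
  ultimately have "?r\<^sup>2 * z < 1" by simp
  then show ?thesis
    using complement_pattern[OF AC off BD pm(2-4) V P AVP Z s z] by blast
qed

section \<open>Hadamard matrices and the threshold inequality\<close>

lemma hadamard_gram:
  fixes H :: "real^'n^'n"
  assumes "hadamard_matrix H"
  shows "H ** transpose H = real CARD('n) *\<^sub>R mat 1" "transpose H ** H = real CARD('n) *\<^sub>R mat 1"
proof -
  let ?n = "real CARD('n)"
  have sq: "H $ i $ j * H $ i $ j = 1" for i j
    using assms pm1_cases[of H i j] by (auto simp: hadamard_matrix_def)
  have "row i H \<bullet> row i H = ?n" for i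
    by (simp add: row_def inner_vec_def sq)
  then show 1: "H ** transpose H = ?n *\<^sub>R mat 1"
    using assms
    by (simp add: matrix_mult_transpose_dot_row vec_eq_iff mat_def hadamard_matrix_def orthogonal_def)
  then have "H ** ((1 / ?n) *\<^sub>R transpose H) = mat 1"
    by (simp add: matrix_mult_scaleR)
  then have "((1 / ?n) *\<^sub>R transpose H) ** H = mat 1"
    using matrix_left_right_inverse by blast
  then have "?n *\<^sub>R (((1 / ?n) *\<^sub>R transpose H) ** H) = ?n *\<^sub>R mat 1" by simp
  then show "transpose H ** H = ?n *\<^sub>R mat 1"
    by (simp add: scaleR_matrix_mult)
qed

lemma sum_UNIV_sum_type:
  "(\<Sum>x\<in>UNIV. f x) = (\<Sum>a\<in>UNIV. f (Inl a)) + (\<Sum>b\<in>UNIV. f (Inr b))"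
  for f :: "'a::finite + 'b::finite \<Rightarrow> real"
  unfolding UNIV_sum
  by (subst sum.union_disjoint) (auto simp: sum.reindex)

lemma block_gram:
  fixes A :: "real^'r^'r" and B :: "real^'d^'r" and C :: "real^'r^'d" and D :: "real^'d^'d"
  assumes "transpose (block_matrix A B C D) ** block_matrix A B C D = c *\<^sub>R mat 1"
  shows "transpose A ** A + transpose C ** C = c *\<^sub>R mat 1"
    and "transpose A ** B + transpose C ** D = 0"
    and "transpose B ** B + transpose D ** D = c *\<^sub>R mat 1"
proof -
  have "(transpose (block_matrix A B C D) ** block_matrix A B C D) $ x $ y
      = (c *\<^sub>R mat 1) $ x $ y" for x y
    using assms by simp
  note entry = this[unfolded matrix_matrix_mult_def transpose_def block_matrix_def mat_def,
      simplified, unfolded sum_UNIV_sum_type, simplified]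
  show "transpose A ** A + transpose C ** C = c *\<^sub>R mat 1"
    using entry[of "Inl _" "Inl _"]
    by (simp add: vec_eq_iff matrix_matrix_mult_def transpose_def mat_def)
  show "transpose A ** B + transpose C ** D = 0"
    using entry[of "Inl _" "Inr _"]
    by (simp add: vec_eq_iff matrix_matrix_mult_def transpose_def mat_def)
  show "transpose B ** B + transpose D ** D = c *\<^sub>R mat 1"
    using entry[of "Inr _" "Inr _"]
    by (simp add: vec_eq_iff matrix_matrix_mult_def transpose_def mat_def)
qed

lemma block_pm1:
  assumes "pm1_matrix (block_matrix A B C D)"
  shows "pm1_matrix A" "pm1_matrix B" "pm1_matrix C" "pm1_matrix D"
proof -
  have entry: "block_matrix A B C D $ x $ y \<in> {-1, 1}" for x y
    using assms unfolding pm1_matrix_def by blast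
  show "pm1_matrix A" "pm1_matrix B" "pm1_matrix C" "pm1_matrix D"
    using entry[of "Inl _" "Inl _"] entry[of "Inl _" "Inr _"]
      entry[of "Inr _" "Inl _"] entry[of "Inr _" "Inr _"]
    by (simp_all add: pm1_matrix_def block_matrix_def)
qed

text \<open>The right-hand side of the hypothesis is the square of the larger root \<open>t\<close> of
  \<open>t\<^sup>2 = p t + q\<close>. This converts the closed-form thresholds on \<open>N\<close> into inequalities in \<open>\<surd>N\<close>.\<close>

lemma greater_than_quadratic_root:
  fixes p q s :: real
  assumes p: "0 \<le> p" and q: "0 \<le> q" and s: "0 \<le> s"
    and big: "s\<^sup>2 > (p + sqrt (p\<^sup>2 + 4 * q))\<^sup>2 / 4"
  shows "s\<^sup>2 > p * s + q"
proof -
  define t where "t = (p + sqrt (p\<^sup>2 + 4 * q)) / 2"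
  have root: "(sqrt (p\<^sup>2 + 4 * q))\<^sup>2 = p\<^sup>2 + 4 * q" using q by simp
  have t2: "t * (t - p) = q"
    using root unfolding t_def by (simp add: field_simps power2_eq_square)
  have "p \<le> sqrt (p\<^sup>2 + 4 * q)" using p q by (simp add: real_le_rsqrt)
  then have tp: "p \<le> t" by (simp add: t_def)
  have "t\<^sup>2 < s\<^sup>2" using big by (simp add: t_def power_divide)
  then have ts: "t < s" using s by (rule power2_less_imp_less)
  have "t * (t - p) < s * (s - p)"
    using ts tp p by (intro mult_strict_mono') auto
  then have "q < s * (s - p)" unfolding t2 .
  then show ?thesis by (simp add: power2_eq_square algebra_simps)
qed

lemma abs_entry_le_entry_max_norm: "\<bar>M $ i $ j\<bar> \<le> entry_max_norm M"
  for M :: "real^'n^'m"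
proof -
  have "{\<bar>M $ i $ j\<bar> | i j. True} = range (\<lambda>(i, j). \<bar>M $ i $ j\<bar>)" by auto
  then have "finite {\<bar>M $ i $ j\<bar> | i j. True}" by simp
  then show ?thesis unfolding entry_max_norm_def by (intro Max_ge) auto
qed

lemma abs_entry_orthogonal_le_1:
  fixes V :: "real^'n^'n"
  assumes "orthogonal_matrix V"
  shows "\<bar>V $ i $ j\<bar> \<le> 1"
proof -
  have "norm (row i V) = 1" using assms by (simp add: orthogonal_matrix_orthonormal_rows)
  then show ?thesis using component_le_norm_cart[of "row i V" j] by (simp add: row_def)
qed

section \<open>Complements of square blocks in Hadamard matrices\<close>

theorem theorem3p4:
  fixes A :: "real^'r^'r" and B :: "real^'d^'r" and C :: "real^'r^'d" and D :: "real^'d^'d"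
    and H :: "real^('r + 'd)^('r + 'd)"
    and r d N :: nat
  assumes "r = CARD('r)" and "d = CARD('d)" and "N = r + d"
    and "H = block_matrix A B C D"
    and "hadamard_matrix H"
  shows "(hadamard_matrix A \<and> real N > real r * (real r - 1)\<^sup>2 \<longrightarrow> almost_hadamard_pattern D) \<and>
    (let x = real r * entry_max_norm (Pol A - (1 / sqrt (real N)) *\<^sub>R A) in
       invertible A \<and> real N > (real r)\<^sup>2 / 4 * (x + sqrt (x\<^sup>2 + 4))\<^sup>2 \<longrightarrow> almost_hadamard_pattern D) \<and>
    (invertible A \<and> real N > (real r)\<^sup>2 / 4 * (real r + sqrt ((real r)\<^sup>2 + 8))\<^sup>2 \<longrightarrow>
       almost_hadamard_pattern D)"
proof -
  define s where "s = sqrt (real N)"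
  have r1: "real r \<ge> 1" using assms(1) by (simp add: Suc_leI)
  have N: "real N > 0" using assms(3) r1 by auto
  have s: "s > 0" and s2: "s\<^sup>2 = real N" using N by (auto simp: s_def)
  have card: "real CARD('r + 'd) = s\<^sup>2"
    using assms(1-3) by (simp add: s2)
  have gram: "transpose (block_matrix A B C D) ** block_matrix A B C D = s\<^sup>2 *\<^sub>R mat 1"
    using hadamard_gram(2)[OF assms(5)] assms(4) card by simp
  note blocks = block_gram[OF gram]
  have "pm1_matrix (block_matrix A B C D)" using assms(4,5) by (simp add: hadamard_matrix_def)
  note pm = block_pm1[OF this]
  have hadamard_case: "almost_hadamard_pattern D"
    if A: "hadamard_matrix A" and big: "real N > real r * (real r - 1)\<^sup>2"
  proof -
    \<comment> \<open>Here \<open>A\<^sup>t A = r\<close>, so the polar decomposition is \<open>A = (A / \<surd>r) \<surd>r\<close> and \<open>Z\<close> is explicit.\<close>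
    define t where "t = sqrt (real r)"
    have t: "t > 0" and t2: "t * t = real r" using r1 by (auto simp: t_def)
    define V where "V = (1 / t) *\<^sub>R A"
    define Z where "Z = (1 / (s + t)) *\<^sub>R transpose V"
    have V: "orthogonal_matrix V"
      using hadamard_gram(2)[OF A] t r1
      by (simp add: orthogonal_matrix V_def transpose_scalar scaleR_matrix_mult matrix_mult_scaleR
          t2 flip: assms(1))
    have P: "psd_matrix (t *\<^sub>R mat 1 :: real^'r^'r)" using t by (intro psd_scaleR psd_mat_1) simp
    have AVP: "A = V ** (t *\<^sub>R mat 1)" using t by (simp add: V_def matrix_mult_scaleR)
    have Z: "(s *\<^sub>R mat 1 + t *\<^sub>R mat 1) ** Z = transpose V"
      using s t by (simp add: Z_def scaleR_matrix_mult matrix_mult_scaleR flip: scaleR_add_left)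
    have z: "\<bar>Z $ i $ j\<bar> \<le> 1 / ((s + t) * t)" for i j
    proof -
      have "\<bar>A $ j $ i\<bar> = 1" by (rule pm1_abs[OF pm(1)])
      then show ?thesis using s t by (simp add: Z_def V_def transpose_def abs_mult)
    qed
    have "(t * (t * t - 1))\<^sup>2 = real r * (real r - 1)\<^sup>2"
      by (simp add: t2[symmetric] power_mult_distrib power2_eq_square mult_ac)
    then have "(t * (t * t - 1))\<^sup>2 < s\<^sup>2" using big by (simp add: s2)
    then have "t * (t * t - 1) < s" using s by (simp add: power2_less_imp_less)
    then have "t * t * t < s + t" by (simp add: algebra_simps)
    then have "(t * t * t) * t < (s + t) * t" using t by (intro mult_strict_right_mono)
    then have small: "(real CARD('r))\<^sup>2 * (1 / ((s + t) * t)) < 1"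
      using s t by (simp add: assms(1)[symmetric] t2[symmetric] power2_eq_square mult_ac)
    show ?thesis
      by (rule complement_pattern[OF blocks pm(2-4) V P AVP Z s z small])
  qed
  obtain V P where V: "orthogonal_matrix V" and P: "psd_matrix P" and AVP: "A = V ** P"
    by (rule polar_decomposition_exists)
  have Pol_case: "almost_hadamard_pattern D"
    if inv: "invertible A" and x: "x = real r * entry_max_norm (Pol A - (1 / sqrt (real N)) *\<^sub>R A)"
      and big: "real N > (real r)\<^sup>2 / 4 * (x + sqrt (x\<^sup>2 + 4))\<^sup>2" for x
  proof -
    define m where "m = entry_max_norm (V - (1 / s) *\<^sub>R A)"
    have m: "\<bar>(V - (1 / s) *\<^sub>R A) $ i $ j\<bar> \<le> m" for i j
      unfolding m_def by (rule abs_entry_le_entry_max_norm)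
    have m0: "m \<ge> 0" using order_trans[OF abs_ge_zero m] .
    have x: "x = real r * m" by (simp add: x m_def s_def Pol_eq[OF inv V P AVP])
    \<comment> \<open>Scaled by \<open>r\<close>, the threshold is the root of \<open>t\<^sup>2 = r x t + r\<^sup>2\<close>.\<close>
    have "real r * sqrt (x\<^sup>2 + 4) = sqrt ((real r * x)\<^sup>2 + 4 * (real r)\<^sup>2)"
    proof -
      have "sqrt ((real r)\<^sup>2 * (x\<^sup>2 + 4)) = real r * sqrt (x\<^sup>2 + 4)"
        by (simp add: real_sqrt_mult)
      then show ?thesis by (simp add: algebra_simps power_mult_distrib)
    qed
    moreover have "(real r)\<^sup>2 / 4 * (x + sqrt (x\<^sup>2 + 4))\<^sup>2
        = (real r * x + real r * sqrt (x\<^sup>2 + 4))\<^sup>2 / 4"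
      unfolding distrib_left[symmetric] power_mult_distrib by simp
    ultimately have "s\<^sup>2 > real r * x * s + (real r)\<^sup>2"
      using big s m0 by (intro greater_than_quadratic_root) (auto simp: s2 x)
    then have "s\<^sup>2 > (real CARD('r))\<^sup>2 * s * m + (real CARD('r))\<^sup>2"
      by (simp add: x assms(1)[symmetric] power2_eq_square mult_ac)
    then show ?thesis
      by (rule complement_pattern_of_Pol_bound[OF blocks pm V P AVP s m])
  qed
  have general_case: "almost_hadamard_pattern D"
    if big: "real N > (real r)\<^sup>2 / 4 * (real r + sqrt ((real r)\<^sup>2 + 8))\<^sup>2"
  proof -
    have m: "\<bar>(V - (1 / s) *\<^sub>R A) $ i $ j\<bar> \<le> 1 + 1 / s" for i j
    proof -
      have "\<bar>A $ i $ j\<bar> = 1" by (rule pm1_abs[OF pm(1)])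
      then have "\<bar>(1 / s) * A $ i $ j\<bar> = 1 / s" using s by (simp add: abs_mult)
      moreover have "\<bar>V $ i $ j\<bar> \<le> 1" by (rule abs_entry_orthogonal_le_1[OF V])
      ultimately show ?thesis
        using abs_triangle_ineq4[of "V $ i $ j" "(1 / s) * A $ i $ j"] by simp
    qed
    \<comment> \<open>Scaled by \<open>r\<close>, the threshold is the root of \<open>t\<^sup>2 = r\<^sup>2 t + 2 r\<^sup>2\<close>.\<close>
    have "real r * sqrt ((real r)\<^sup>2 + 8) = sqrt (((real r)\<^sup>2)\<^sup>2 + 4 * (2 * (real r)\<^sup>2))"
    proof -
      have "sqrt ((real r)\<^sup>2 * ((real r)\<^sup>2 + 8)) = real r * sqrt ((real r)\<^sup>2 + 8)"
        by (simp add: real_sqrt_mult)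
      then show ?thesis by (simp add: algebra_simps power2_eq_square)
    qed
    moreover have "(real r)\<^sup>2 / 4 * (real r + sqrt ((real r)\<^sup>2 + 8))\<^sup>2
        = ((real r)\<^sup>2 + real r * sqrt ((real r)\<^sup>2 + 8))\<^sup>2 / 4"
      unfolding power2_eq_square[of "real r"] distrib_left[symmetric]
      by (simp add: power2_eq_square)
    ultimately have "s\<^sup>2 > (real r)\<^sup>2 * s + 2 * (real r)\<^sup>2"
      using big s by (intro greater_than_quadratic_root) (auto simp: s2)
    moreover have "s * (1 + 1 / s) = s + 1" using s by (simp add: field_simps)
    ultimately have "s\<^sup>2 > (real CARD('r))\<^sup>2 * s * (1 + 1 / s) + (real CARD('r))\<^sup>2"
      by (simp only: assms(1)[symmetric] mult.assoc) (simp add: algebra_simps)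
    then show ?thesis
      by (rule complement_pattern_of_Pol_bound[OF blocks pm V P AVP s m])
  qed
  show ?thesis
    unfolding Let_def using hadamard_case Pol_case[OF _ refl] general_case by blast
qed

end
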